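(* For every integer $a\ge 2$, \[M_1(a)\le 2+2\frac{\log a}{W\left(\frac12\log a\right)}.\] Consequently, as $a\to\infty$, \[M_1(a)=O\left(\frac{\log a}{\log\log a-\log\log\log a}\right).\]
   Context: $\left[ {n \atop k} \right]$ denotes the (unsigned) Stirling number of the first kind: the number of permutations of $n$ letters having exactly $k$ cycles. For a non-negative integer $a$, $M_1(a)$ is the number of pairs $(n,k)$ of non-negative integers with $\left[ {n \atop k} \right]=a$, i.e. the number of times $a$ appears in the triangle of Stirling numbers of the first kind. $W$ is the (principal branch of the) Lambert $W$ function, defined for $x>0$ as the unique positive solution $w$ of $we^{w}=x$. $\log$ is the natural logarithm. *)

theory Defs
  imports
    Complex_Main
    "HOL-Library.Landau_Symbols"
    "HOL-Combinatorics.Stirling"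
    "HOL-Combinatorics.Permutations"
    "HOL-Combinatorics.Orbits"
begin

text \<open>
  The library constant \<^const>\<open>stirling\<close> is defined by the usual recurrence. The lemma
  \<open>card_permutes_cycles_eq_stirling\<close> shows that it counts permutations by their number of cycles
  (fixed points included), where the cycles of \<open>p\<close> on \<open>S\<close> are the sets \<open>orbit p x\<close> for \<open>x \<in> S\<close>.
\<close>

lemma orbit_transpose_comp:
  assumes q: "q permutes S" and S: "finite S" and a: "a \<notin> S" and b: "b \<in> S" and x: "x \<in> S"
  defines "p \<equiv> transpose a b \<circ> q"
  shows "orbit p x = (if b \<in> orbit q x then insert a (orbit q x) else orbit q x)"
    and "orbit p a = orbit p b"
proof -
  have qa: "q a = a" using q a by (simp add: permutes_not_in)
  have pa: "p a = b" by (simp add: p_def qa)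
  have qS: "q y \<in> S" if "y \<in> S" for y using q that by (simp add: permutes_in_image)
  have pb: "p y = a" if "y \<in> S" "q y = b" for y using that by (simp add: p_def)
  have pq: "p y = q y" if "y \<in> S" "q y \<noteq> b" for y
    using that qS[OF that(1)] a by (auto simp: p_def transpose_def)
  have "p permutes insert a S"
    unfolding p_def using b
    by (intro permutes_compose[OF permutes_subset[OF q]] permutes_swap_id) auto
  then have perm: "permutation p" using S by (auto simp: permutation_permutes)
  show ab: "orbit p a = orbit p b" using permutation_orbit_step[OF perm, of a] pa by simp
  have sub: "orbit q x \<subseteq> S" by (rule permutes_orbit_subset[OF q x])
  have 1: "y \<in> orbit q x \<or> (y = a \<and> b \<in> orbit q x)" if "y \<in> orbit p x" for y
    using that
  proof induction
    case base
    show ?case using pb[OF x] pq[OF x] orbit.base[of q x] by (cases "q x = b") auto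
  next
    case (step y)
    show ?case
    proof (cases "y = a")
      case True
      then show ?thesis using step.IH pa sub a by auto
    next
      case False
      then have y: "y \<in> orbit q x" using step.IH by auto
      then have "y \<in> S" using sub by auto
      then show ?thesis using pb pq orbit.step[OF y] by (cases "q y = b") auto
    qed
  qed
  have 2: "y \<in> orbit p x" if "y \<in> orbit q x" for y
    using that
  proof induction
    case base
    show ?case
      using pb[OF x] pq[OF x] orbit.base[of p x] orbit.step[of a p x] pa by (cases "q x = b") auto
  next
    case (step y)
    then have "y \<in> S" using sub by auto
    then show ?case
      using pb[of y] pq[of y] orbit.step[OF step.IH] orbit.step[of a p x] pa by (cases "q y = b") auto
  qed
  have "a \<in> orbit p b" using permutation_self_in_orbit[OF perm, of a] ab by simp
  then have 3: "a \<in> orbit p x" if "b \<in> orbit q x" using 2[OF that] by (rule orbit_trans)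
  show "orbit p x = (if b \<in> orbit q x then insert a (orbit q x) else orbit q x)"
    using 1 2 3 by auto
qed

lemma card_orbits_insert:
  assumes q: "q permutes S" and S: "finite S" and a: "a \<notin> S" and b: "b \<in> insert a S"
  shows "card (orbit (transpose a b \<circ> q) ` insert a S) =
    (if b = a then Suc (card (orbit q ` S)) else card (orbit q ` S))"
proof -
  have na: "a \<notin> orbit q x" if "x \<in> S" for x
    using permutes_orbit_subset[OF q that] a by auto
  show ?thesis
  proof (cases "b = a")
    case True
    have "q a = a" using q a by (simp add: permutes_not_in)
    then have "orbit q a = {a}" by (simp add: orbit_eq_singleton_iff)
    moreover have "{a} \<notin> orbit q ` S" using na by force
    ultimately show ?thesis using True S by simp
  next
    case False
    define F where "F C = (if b \<in> C then insert a C else C)" for C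
    have bS: "b \<in> S" using b False by auto
    have "orbit (transpose a b \<circ> q) ` insert a S = orbit (transpose a b \<circ> q) ` S"
      using orbit_transpose_comp(2)[OF q S a bS bS] bS by auto
    also have "\<dots> = F ` (orbit q ` S)"
      unfolding image_image F_def
      by (intro image_cong refl orbit_transpose_comp(1)[OF q S a bS])
    finally have eq: "orbit (transpose a b \<circ> q) ` insert a S = F ` (orbit q ` S)" .
    have "inj_on F (orbit q ` S)"
    proof (rule inj_onI)
      fix C D assume "C \<in> orbit q ` S" "D \<in> orbit q ` S" and FF: "F C = F D"
      then have "a \<notin> C" "a \<notin> D" using na by auto
      then have "F C - {a} = C" "F D - {a} = D" by (auto simp: F_def)
      with FF show "C = D" by metis
    qed
    then show ?thesis using False eq by (simp add: card_image)
  qed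
qed

lemma card_permutes_cycles_eq_stirling:
  assumes "finite S"
  shows "card {p. p permutes S \<and> card (orbit p ` S) = k} = stirling (card S) k"
  using assms
proof (induction S arbitrary: k rule: finite_induct)
  case empty
  have "{p::'a \<Rightarrow> 'a. p = id \<and> k = 0} = (if k = 0 then {id} else {})" by auto
  then show ?case by (cases k) (simp_all cong: conj_cong)
next
  case (insert a S)
  define P where "P j = {q. q permutes S \<and> card (orbit q ` S) = j}" for j
  define g where "g = (\<lambda>(b, q). transpose a b \<circ> (q :: 'a \<Rightarrow> 'a))"
  have fin: "finite (P j)" for j
    unfolding P_def by (rule finite_subset[OF _ finite_permutations[OF insert.hyps(1)]]) auto
  have card_P: "card (P j) = stirling (card S) j" for j
    unfolding P_def by (rule insert.IH)
  show ?case
  proof (cases k)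
    case 0
    have "{p. p permutes insert a S \<and> card (orbit p ` insert a S) = 0} = {}"
      using insert.hyps by auto
    then show ?thesis using insert.hyps 0 by (simp add: card_gt_0_iff del: image_insert)
  next
    case (Suc j)
    let ?D = "{a} \<times> P j \<union> S \<times> P k"
    have inj: "inj_on g ?D"
    proof (rule inj_onI)
      fix u v assume u: "u \<in> ?D" and v: "v \<in> ?D" and eq: "g u = g v"
      obtain b q c r where uv: "u = (b, q)" "v = (c, r)" by (cases u; cases v) auto
      have "q permutes S" "r permutes S" using u v uv by (auto simp: P_def)
      then have "q a = a" "r a = a" using insert.hyps by (simp_all add: permutes_not_in)
      moreover have eq': "transpose a b \<circ> q = transpose a c \<circ> r" using eq uv by (simp add: g_def)
      ultimately have bc: "b = c" by (metis comp_apply transpose_apply_first)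
      have "transpose a b \<circ> (transpose a b \<circ> q) = transpose a b \<circ> (transpose a b \<circ> r)"
        using eq' bc by simp
      then have "q = r" by (simp add: o_assoc)
      with bc uv show "u = v" by simp
    qed
    have "{p. p permutes insert a S \<and> card (orbit p ` insert a S) = k} = g ` ?D"
    proof (intro equalityI subsetI)
      fix p assume "p \<in> {p. p permutes insert a S \<and> card (orbit p ` insert a S) = k}"
      then have p: "p permutes insert a S" "card (orbit p ` insert a S) = k" by auto
      have "p \<in> {p. p permutes insert a S}" using p(1) by simp
      then obtain b q where bq: "b \<in> insert a S" "q permutes S" "p = transpose a b \<circ> q"
        unfolding permutes_insert by auto
      have "(b, q) \<in> ?D"
        using card_orbits_insert[OF bq(2) insert.hyps(1,2) bq(1)] p(2) bq Suc
        by (auto simp: P_def split: if_splits simp del: image_insert)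
      then show "p \<in> g ` ?D" using bq by (force simp: g_def)
    next
      fix p assume "p \<in> g ` ?D"
      then obtain b q where bq: "(b, q) \<in> ?D" "p = transpose a b \<circ> q" by (auto simp: g_def)
      have b: "b \<in> insert a S" and q: "q permutes S" using bq by (auto simp: P_def)
      have "p permutes insert a S"
        unfolding bq(2) using b
        by (intro permutes_compose[OF permutes_subset[OF q]] permutes_swap_id) auto
      moreover have "card (orbit p ` insert a S) = k"
        using card_orbits_insert[OF q insert.hyps(1,2) b] bq insert.hyps(2) Suc
        by (auto simp: P_def simp del: image_insert)
      ultimately show "p \<in> {p. p permutes insert a S \<and> card (orbit p ` insert a S) = k}" by simp
    qed
    then have "card {p. p permutes insert a S \<and> card (orbit p ` insert a S) = k} = card ?D"
      using inj by (simp add: card_image)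
    also have "\<dots> = card ({a} \<times> P j) + card (S \<times> P k)"
      using insert.hyps fin by (intro card_Un_disjoint) auto
    also have "\<dots> = stirling (card (insert a S)) k"
      using insert.hyps by (simp add: card_P Suc card_cartesian_product)
    finally show ?thesis .
  qed
qed


definition M1 :: "nat \<Rightarrow> nat" where
  "M1 a = card {(n, k). stirling n k = a}"

text \<open>
  For \<open>a \<ge> 2\<close> the set of occurrences is finite, so \<^const>\<open>card\<close> is the true number of
  occurrences; for \<open>a \<le> 1\<close> there are infinitely many and \<open>M1 a\<close> is meaningless.
\<close>

lemma stirling_lower_bound:
  assumes "0 < k" "k < n"
  shows "n - 1 \<le> stirling n k"
  using assms
proof (induction n arbitrary: k)
  case (Suc n)
  obtain j where k: "k = Suc j" using Suc.prems by (cases k) auto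
  have "1 \<le> stirling n k"
    using Suc.IH[of k] Suc.prems by (cases "k = n") (auto simp: k)
  then have "n * 1 \<le> n * stirling n k" by (intro mult_le_mono2)
  also have "\<dots> \<le> stirling (Suc n) k" by (simp add: k)
  finally show ?case by simp
qed simp

lemma finite_stirling_occurrences:
  assumes "2 \<le> a"
  shows "finite {(n, k). stirling n k = a}"
proof (rule finite_subset)
  show "{(n, k). stirling n k = a} \<subseteq> {..Suc a} \<times> {..Suc a}"
  proof
    fix x assume "x \<in> {(n, k). stirling n k = a}"
    then obtain n k where x: "x = (n, k)" and eq: "stirling n k = a" by auto
    have "0 < k" using eq assms by (cases n; cases k) auto
    moreover have "k < n" using eq assms by (cases n k rule: linorder_cases) auto
    ultimately show "x \<in> {..Suc a} \<times> {..Suc a}"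
      using stirling_lower_bound[of k n] eq x by auto
  qed
qed simp


definition Lambert_W :: "real \<Rightarrow> real" where
  "Lambert_W x = (THE w. 0 < w \<and> w * exp w = x)"

lemma Lambert_W_ex1:
  fixes x :: real
  assumes "0 < x"
  shows "\<exists>!w. 0 < w \<and> w * exp w = x"
proof -
  have mono: "v * exp v < w * exp w" if "0 < v" "v < w" for v w :: real
    using that by (intro mult_strict_mono) auto
  have "\<exists>w\<ge>0. w \<le> x \<and> w * exp w = x"
  proof (rule IVT')
    show "x \<le> x * exp x" using assms by simp
  qed (use assms in \<open>auto intro!: continuous_intros\<close>)
  then obtain w where w: "0 \<le> w" "w * exp w = x" by blast
  show ?thesis
  proof (rule ex1I[of _ w])
    show "0 < w \<and> w * exp w = x" using w assms by (cases "w = 0") auto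
    then show "v = w" if "0 < v \<and> v * exp v = x" for v
      using mono[of v w] mono[of w v] that by (cases v w rule: linorder_cases) auto
  qed
qed

lemma Lambert_W_pos: "0 < x \<Longrightarrow> 0 < Lambert_W x"
  and Lambert_W_mult_exp: "0 < x \<Longrightarrow> Lambert_W x * exp (Lambert_W x) = x"
  using theI'[OF Lambert_W_ex1, of x] by (auto simp: Lambert_W_def)

end

theory Submission
  imports Defs
begin

text \<open>
  Along a column (\<open>k\<close> fixed) and along a diagonal (\<open>n - k\<close> fixed) the entries \<open>\<ge> 2\<close> of the triangle
  are strictly increasing, so each column and each diagonal contains \<open>a\<close> at most once. Since
  \<open>stirling (k + r) k \<ge> k ^ r\<close>, an occurrence of \<open>a\<close> with \<open>k, r \<ge> t\<close> forces \<open>t ^ t \<le> a\<close>; writing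
  \<open>a = m powr (2 * m)\<close> with \<open>m = exp (W (ln a / 2))\<close>, this gives \<open>t \<le> 2 * m\<close>. Hence every occurrence
  lies in one of the first \<open>2 * m\<close> columns or diagonals, and \<open>M1 a \<le> 4 * m\<close>.
\<close>

lemma stirling_pos:
  assumes "0 < k" "k \<le> n"
  shows "0 < stirling n k"
  using stirling_lower_bound[of k n] assms by (cases "k = n") auto

text \<open>On the edges \<open>k = 0\<close> and \<open>k = n\<close> and beyond
  \<open>k > n\<close>, all entries are 0 or 1.\<close>

lemma stirling_occurrence_bounds:
  assumes "stirling n k = a" "2 \<le> a"
  shows "0 < k" "k < n"
proof -
  show "0 < k" using assms by (cases n; cases k) auto
  show "k < n" using assms by (cases n k rule: linorder_cases) auto
qed

text \<open>From row \<open>Suc k\<close> on, the recurrence multiplies by a row index of at least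
  2. Row \<open>k\<close> is left out because the entries (1,1) and (2,1) are both 1.\<close>

lemma strict_mono_stirling_column:
  assumes "0 < k"
  shows "strict_mono (\<lambda>i. stirling (Suc k + i) k)"
proof (rule strict_mono_Suc_iff[THEN iffD2], intro allI)
  fix i
  obtain j where k: "k = Suc j" using assms by (cases k) auto
  define n where "n = Suc k + i"
  have pos: "0 < stirling n k" using assms by (intro stirling_pos) (auto simp: n_def)
  have "2 * stirling n k \<le> n * stirling n k" by (intro mult_le_mono1) (simp add: n_def k)
  then have "stirling n k < n * stirling n k + stirling n j" using pos by linarith
  then show "stirling (Suc k + i) k < stirling (Suc k + Suc i) k" by (simp add: n_def k)
qed

text \<open>A diagonal step adds a positive multiple of the entry to the right in the same row. That
  entry is nonzero because \<open>r > 0\<close>; the diagonal \<open>r = 0\<close> is constantly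
  1.\<close>

lemma strict_mono_stirling_diagonal:
  assumes "0 < r"
  shows "strict_mono (\<lambda>i. stirling (Suc i + r) (Suc i))"
proof (rule strict_mono_Suc_iff[THEN iffD2], intro allI)
  fix i
  have "0 < stirling (Suc i + r) (Suc (Suc i))" using assms by (intro stirling_pos) auto
  then show "stirling (Suc i + r) (Suc i) < stirling (Suc (Suc i) + r) (Suc (Suc i))" by simp
qed

lemma stirling_column_inj:
  assumes "stirling n k = stirling n' k" "0 < k" "k < n" "k < n'"
  shows "n = n'"
proof -
  have n: "n = Suc k + (n - Suc k)" "n' = Suc k + (n' - Suc k)" using assms(3,4) by auto
  have "stirling (Suc k + (n - Suc k)) k = stirling (Suc k + (n' - Suc k)) k"
    using assms(1) n by argo
  then have "n - Suc k = n' - Suc k"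
    using strict_mono_eq[OF strict_mono_stirling_column[OF assms(2)]] by blast
  then show ?thesis using assms(3,4) by linarith
qed

lemma stirling_diagonal_inj:
  assumes "stirling (k + r) k = stirling (k' + r) k'" "0 < r" "0 < k" "0 < k'"
  shows "k = k'"
proof -
  obtain i j where ij: "k = Suc i" "k' = Suc j" using assms(3,4) by (meson gr0_implies_Suc)
  have "stirling (Suc i + r) (Suc i) = stirling (Suc j + r) (Suc j)"
    using assms(1) unfolding ij .
  then have "i = j" using strict_mono_eq[OF strict_mono_stirling_diagonal[OF assms(2)]] by blast
  then show ?thesis using ij by simp
qed

text \<open>Each of the \<open>r\<close> steps down column \<open>k\<close>, starting from the entry
  1, multiplies by a row index that is at least \<open>k\<close>.\<close>

lemma power_le_stirling:
  assumes "0 < k"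
  shows "k ^ r \<le> stirling (k + r) k"
proof (induction r)
  case (Suc r)
  obtain j where k: "k = Suc j" using assms by (cases k) auto
  have "k * k ^ r \<le> (k + r) * stirling (k + r) k" using Suc by (intro mult_le_mono) auto
  also have "\<dots> \<le> stirling (k + Suc r) k" by (simp add: k)
  finally show ?case by simp
qed simp

text \<open>This isolates the counting: all that remains is to bound the solutions of
  \<open>t ^ t \<le> a\<close>.\<close>

lemma M1_le:
  assumes a: "2 \<le> a" and T: "\<And>t. 0 < t \<Longrightarrow> t ^ t \<le> a \<Longrightarrow> t \<le> T"
  shows "M1 a \<le> 2 * T"
proof -
  let ?S = "{(n, k). stirling n k = a}"
  let ?C = "{p \<in> ?S. snd p \<le> T}" and ?D = "{p \<in> ?S. fst p - snd p \<le> T}"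
  have bounds: "0 < k" "k < n" if "stirling n k = a" for n k
    using stirling_occurrence_bounds[OF that a] by auto
  have "?S \<subseteq> ?C \<union> ?D"
  proof
    fix p assume "p \<in> ?S"
    then obtain n k where p: "p = (n, k)" and nk: "stirling n k = a" by auto
    define r where "r = n - k"
    define t where "t = min k r"
    have t: "0 < t" "t \<le> k" "t \<le> r" using bounds[OF nk] by (auto simp: t_def r_def)
    have "t ^ t \<le> k ^ t" using t by (intro power_mono) auto
    also have "\<dots> \<le> k ^ r" using t by (intro power_increasing) auto
    also have "\<dots> \<le> stirling (k + r) k" using t by (intro power_le_stirling) auto
    also have "\<dots> = a" using nk bounds[OF nk] by (simp add: r_def)
    finally have "t \<le> T" using T t by blast
    then show "p \<in> ?C \<union> ?D" using p nk by (auto simp: t_def r_def min_def split: if_splits)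
  qed
  moreover have "finite (?C \<union> ?D)"
    by (rule finite_subset[OF _ finite_stirling_occurrences[OF a]]) blast
  ultimately have "M1 a \<le> card (?C \<union> ?D)"
    unfolding M1_def by (intro card_mono)
  also have "\<dots> \<le> card ?C + card ?D" by (rule card_Un_le)
  \<comment> \<open>An occurrence is determined by its column. Columns are numbered from 1, so there
    are \<open>T\<close> of them rather than \<open>T + 1\<close>; likewise for the diagonals
    below.\<close>
  also have "card ?C \<le> card {1..T}"
  proof (rule card_inj_on_le[where f = snd])
    show "inj_on snd ?C"
    proof (rule inj_onI)
      fix p q assume "p \<in> ?C" "q \<in> ?C" and eq: "snd p = snd q"
      then have st: "stirling (fst p) (snd p) = a" "stirling (fst q) (snd q) = a"
        by (simp_all add: case_prod_beta)
      have "fst p = fst q"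
      proof (rule stirling_column_inj)
        show "stirling (fst p) (snd p) = stirling (fst q) (snd p)" using st unfolding eq by argo
        show "0 < snd p" "snd p < fst p" using bounds[OF st(1)] .
        show "snd p < fst q" using bounds[OF st(2)] unfolding eq by argo
      qed
      then show "p = q" using eq by (rule prod_eqI)
    qed
    show "snd ` ?C \<subseteq> {1..T}"
    proof (rule image_subsetI)
      fix p assume p: "p \<in> ?C"
      then have "stirling (fst p) (snd p) = a" by (simp add: case_prod_beta)
      from bounds(1)[OF this] p show "snd p \<in> {1..T}" by simp
    qed
  qed simp
  also have "card ?D \<le> card {1..T}"
  proof (rule card_inj_on_le[where f = "\<lambda>p. fst p - snd p"])
    show "inj_on (\<lambda>p. fst p - snd p) ?D"
    proof (rule inj_onI)
      fix p q assume "p \<in> ?D" "q \<in> ?D" and eq: "fst p - snd p = fst q - snd q"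
      then have st: "stirling (fst p) (snd p) = a" "stirling (fst q) (snd q) = a"
        by (simp_all add: case_prod_beta)
      note b = bounds[OF st(1)] bounds[OF st(2)]
      define r where "r = fst p - snd p"
      have r: "fst p = snd p + r" "fst q = snd q + r" "0 < r" using b eq by (auto simp: r_def)
      have "snd p = snd q"
        using st unfolding r(1,2) by (intro stirling_diagonal_inj[OF _ r(3) b(1,3)]) argo
      with r(1,2) show "p = q" by (simp add: prod_eq_iff)
    qed
    show "(\<lambda>p. fst p - snd p) ` ?D \<subseteq> {1..T}"
    proof (rule image_subsetI)
      fix p assume p: "p \<in> ?D"
      then have "stirling (fst p) (snd p) = a" by (simp add: case_prod_beta)
      from bounds(2)[OF this] p show "fst p - snd p \<in> {1..T}" by simp
    qed
  qed simp
  finally show ?thesis by simp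
qed

text \<open>Starting both index ranges at 1 is what saves the additive 2 of the theorem.\<close>

lemma M1_le_Lambert_W:
  assumes a: "2 \<le> a"
  shows "real (M1 a) \<le> 2 * (ln (real a) / Lambert_W (1/2 * ln (real a)))"
proof -
  define w where "w = Lambert_W (1/2 * ln (real a))"
  define m where "m = exp w"
  have L: "0 < 1/2 * ln (real a)" using a by simp
  have w: "0 < w" "w * m = 1/2 * ln (real a)"
    using Lambert_W_pos[OF L] Lambert_W_mult_exp[OF L] by (simp_all add: w_def m_def)
  have m: "1 < m" using w by (simp add: m_def)
  have quot: "ln (real a) / w = 2 * m" using w by (simp add: field_simps)
  have "t \<le> nat \<lfloor>2 * m\<rfloor>" if t: "0 < t" "t ^ t \<le> a" for t :: nat
  proof -
    have "real t \<le> 2 * m"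
    proof (rule ccontr)
      assume "\<not> real t \<le> 2 * m"
      then have gt: "2 * m < real t" by simp
      \<comment> \<open>As \<open>t\<close> exceeds \<open>2 * m\<close> and hence \<open>m\<close>,
        its logarithm is at least \<open>w\<close>. So \<open>t * ln t\<close> exceeds
        \<open>2 * m * w = ln a\<close>, contradicting \<open>t ^ t \<le> a\<close>.\<close>
      have "exp w \<le> real t" using gt m unfolding m_def by linarith
      then have w_le: "w \<le> ln (real t)" using t(1) by (simp add: ln_ge_iff)
      have "ln (real a) = 2 * m * w" using w(2) by argo
      also have "\<dots> < real t * w" using gt w by simp
      also have "\<dots> \<le> real t * ln (real t)" using w_le by (simp add: mult_left_mono)
      also have "\<dots> = ln (real (t ^ t))" using t by (simp add: ln_realpow)
      also have "\<dots> \<le> ln (real a)" using t a by (subst ln_le_cancel_iff) (auto simp del: of_nat_power)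
      finally show False by simp
    qed
    then show ?thesis by (simp add: le_nat_floor)
  qed
  then have "M1 a \<le> 2 * nat \<lfloor>2 * m\<rfloor>" by (rule M1_le[OF a])
  then have "real (M1 a) \<le> 2 * real (nat \<lfloor>2 * m\<rfloor>)" by linarith
  also have "\<dots> \<le> 2 * (2 * m)" using m by simp
  finally show ?thesis using quot by (simp add: w_def)
qed

lemma Lambert_W_half_lower_bound:
  assumes L: "exp 1 \<le> L"
  shows "(ln L - ln (ln L)) / 2 \<le> Lambert_W (1/2 * L)"
proof (rule ccontr)
  define w where "w = Lambert_W (1/2 * L)"
  define D where "D = ln L - ln (ln L)"
  assume "\<not> ?thesis"
  then have less: "w < D / 2" by (simp add: w_def D_def)
  have L0: "0 < L" using L exp_gt_zero[of 1] by linarith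
  have l: "1 \<le> ln L" using L L0 by (simp add: ln_ge_iff)
  have w: "0 < w" "w * exp w = 1/2 * L"
    using Lambert_W_pos[of "1/2 * L"] Lambert_W_mult_exp[of "1/2 * L"] L0 by (simp_all add: w_def)
  have "D \<le> ln L" using l by (simp add: D_def)
  \<comment> \<open>The factors are bounded separately: \<open>w < D / 2 \<le> ln L / 2\<close>, and
    \<open>w < D\<close>. Since \<open>exp D = L / ln L\<close>, the product collapses to
    \<open>L / 2\<close>.\<close>
  then have "w * exp w < ln L / 2 * exp D"
    using less w(1) l by (intro mult_strict_mono) auto
  also have "\<dots> = 1/2 * L" using L0 less_le_trans[OF zero_less_one l] by (simp add: D_def exp_diff)
  finally show False using w by simp
qed

theorem theorem2:
  shows "(\<forall>a::nat. 2 \<le> a \<longrightarrow>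
            real (M1 a) \<le> 2 + 2 * (ln (real a) / Lambert_W (1/2 * ln (real a)))) \<and>
         (\<lambda>a::nat. real (M1 a)) \<in>
            O[at_top](\<lambda>a. ln (real a) / (ln (ln (real a)) - ln (ln (ln (real a)))))"
proof (intro conjI allI impI)
  fix a :: nat assume "2 \<le> a"
  from M1_le_Lambert_W[OF this]
  show "real (M1 a) \<le> 2 + 2 * (ln (real a) / Lambert_W (1/2 * ln (real a)))" by simp
next
  have "filterlim (\<lambda>a::nat. ln (real a)) at_top at_top"
    by (rule filterlim_compose[OF ln_at_top filterlim_real_sequentially])
  then have "eventually (\<lambda>a::nat. exp 1 \<le> ln (real a)) at_top"
    by (simp add: filterlim_at_top)
  \<comment> \<open>The 4 is the factor 2 for columns and diagonals times the 2 lost in bounding W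
    below by \<open>D / 2\<close>.\<close>
  then have "eventually (\<lambda>a::nat. norm (real (M1 a)) \<le>
      4 * norm (ln (real a) / (ln (ln (real a)) - ln (ln (ln (real a)))))) at_top"
    using eventually_ge_at_top[of 2]
  proof eventually_elim
    case (elim a)
    define L where "L = ln (real a)"
    define D where "D = ln L - ln (ln L)"
    have L: "exp 1 \<le> L" using elim by (simp add: L_def)
    have L0: "0 < L" using L exp_gt_zero[of 1] by linarith
    have "1 \<le> ln L" using L L0 by (simp add: ln_ge_iff)
    \<comment> \<open>Positivity of \<open>D\<close> permits replacing W by \<open>D / 2\<close> in
      the denominator and dropping the norm.\<close>
    then have D: "0 < D" using ln_less_self[of "ln L"] by (simp add: D_def)
    have "real (M1 a) \<le> 2 * (L / Lambert_W (1/2 * L))"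
      unfolding L_def using elim by (intro M1_le_Lambert_W)
    also have "\<dots> \<le> 2 * (L / (D / 2))"
      using Lambert_W_half_lower_bound[OF L] D L0
      by (intro mult_left_mono divide_left_mono) (auto simp: D_def)
    also have "\<dots> = 4 * norm (L / D)" using L0 D by simp
    finally show ?case by (simp add: L_def D_def)
  qed
  then show "(\<lambda>a::nat. real (M1 a)) \<in>
      O[at_top](\<lambda>a. ln (real a) / (ln (ln (real a)) - ln (ln (ln (real a)))))"
    by (rule bigoI)
qed

end
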